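(* Let $G_p=\{P,R,f_p,Z,g_p\}$ be the DES-plant automaton associated with a continuous plant $\dot x(t)=f(x(t),u(t))$, a finite control alphabet $R$ with actuator map $act$, and a partition $S_h^N=\{h_1,\dots,h_N\}$ of the continuous state space $X\subseteq\mathbb{R}^n$. Assume that plant-events do not occur simultaneously, i.e. that the evolutions of the plant do not pass through points common to two or more of the hypersurfaces $\mathrm{Ker}(h_i)$. Then $G_p$ is observable: for all $p_a,p_b,p_c\in P$ and $z_j\in Z$, if $z_j=g_p(p_a,p_b)$ and $z_j=g_p(p_a,p_c)$, then $p_b=p_c$.
   Context: **Plant and actuator.** The plant is $\dot x(t)=f(x(t),u(t))$ with $x(t)\in X\subseteq\mathbb{R}^n$ and $u(t)\in U=\{u_1,\dots,u_M\}\subset\mathbb{R}^m$. $R=\{r_1,\dots,r_M\}$ is the alphabet of control-symbols, and $act:R\to U$, $act(r_m)=u_m$, is a bijection. While the symbol $r_m$ is applied, the plant evolves with the constant input $act(r_m)$. **Partition.** $I_N=\{1,\dots,N\}$, $N\ge 1$. $S_h^N=\{h_i:X\to\mathbb{R}\mid i\in I_N\}$ is a set of $N$ functionals of class $C^1$ such that each $\mathrm{Ker}(h_i)=\{x\in X\mid h_i(x)=0\}$ is a nonsingular $(n-1)$-dimensional hypersurface (the gradient of $h_i$ is nonzero at every point of $\mathrm{Ker}(h_i)$). Put $Fr=\bigcup_{i=1}^N\mathrm{Ker}(h_i)$, $DX=X\setminus Fr$, and let $Int$ be the set of $x\in Fr$ such that $x\in\mathrm{Ker}(h_i)\cap\mathrm{Ker}(h_j)$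 for some $h_i\ne h_j$ in $S_h^N$. **Cells and discrete states.** On $DX$ the equivalence relation $Rel$ is: $(x_1,x_2)\in Rel$ iff $h_i(x_1)h_i(x_2)>0$ for all $h_i\in S_h^N$. Its equivalence classes are the cells; $C=\{c_1,\dots,c_Q\}$ is the set of all cells. $P=\{p_1,\dots,p_Q\}$ is a set of $Q$ distinct symbols, and $et:C\to P$, $et(c_q)=p_q$, is a bijection. **Plant-events and plant-symbols.** Let $x(\cdot)$ be a continuous evolution of the plant. The plant-event $(i+)$ (respectively $(i-)$) occurs at time $t_e$ if: (a) $h_i(x(t_e))=0$; (b) there is $d_1>0$ such that for all $0<\varepsilon<d_1$, $h_i(x(t_e+\varepsilon))>0$ (resp. $<0$); (c) there is $d_2>0$ such that $h_i(x(t_e-d_2))<0$ (resp. $>0$) and for all $0<\varepsilon<d_2$, $h_i(x(t_e-\varepsilon))\le 0$ (resp. $\ge 0$). $Z=\{z_{i+},z_{i-}\mid i\in I_N\}$ is a set of $2N$ distinct symbols. When the event $(i+)$ (resp. $(i-)$) occurs at time $t$, with $x(t)\in Fr\setminus Int$, the plant-symbol generated is $gev(x(t))=z_{i+}$ (resp. $z_{i-}$). **Standing hypothesis.** Plant-events do not occur simultaneously; this means that the evolutions considered never pass through $Int$. All evolutions below are assumed to satisfy this. **DES-plant automaton.** $G_p=\{P,R,f_p,Z,g_p\}$ is a nondeterministic automaton with state set $P$, input alphabet $R$, output alphabet $Z$, transition function $f_p:P\times R\to 2^P$, and output function $g_p$ assigning elements of $Z$ to pairs of states between which a transition is possible. For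 $p_a\ne p_b$ in $P$ with cells $c_a=et^{-1}(p_a)$, $c_b=et^{-1}(p_b)$, and $r_m\in R$, one has $p_b\in f_p(p_a,r_m)$ and $g_p(p_a,p_b)=z$ exactly when there are a starting time $t_c$, a point $x_0\in c_a$ and a solution $x(\cdot)$ of $\dot x=f(x,act(r_m))$ with $x(t_c)=x_0$, avoiding $Int$, such that, with $t_e=\inf\{t>t_c\mid x(t)\in DX,\ x(t)\notin c_a\}$ (finite), the trajectory lies in $c_b$ immediately after $t_e$ (i.e. $x(t_e+\varepsilon)\in c_b$ for all sufficiently small $\varepsilon>0$), and $z=gev(x(t_e))$ is the plant-symbol generated at time $t_e$. An equality $z=g_p(p_a,p_b)$ includes the assertion that the transition $p_a\to p_b$ is possible. *)

theory Defs
  imports "HOL-Analysis.Analysis"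
begin

record ('p, 'r, 'z) automaton =
  states :: "'p set"
  inputs :: "'r set"
  trans_fun :: "'p \<Rightarrow> 'r \<Rightarrow> 'p set"
  outputs :: "'z set"
  out_fun :: "'p \<Rightarrow> 'p \<Rightarrow> 'z"

text \<open>The output function is total in HOL, but its value matters only on pairs of states between
  which a transition is possible.  Hence an equality between an output symbol and the value of the
  output function is read as including the possibility of the transition.\<close>

definition emits :: "('p, 'r, 'z) automaton \<Rightarrow> 'p \<Rightarrow> 'p \<Rightarrow> 'z \<Rightarrow> bool" where
  "emits G p q z \<longleftrightarrow> (\<exists>r\<in>inputs G. q \<in> trans_fun G p r) \<and> z = out_fun G p q"

definition observable :: "('p, 'r, 'z) automaton \<Rightarrow> bool" where
  "observable G \<longleftrightarrow>
     (\<forall>pa\<in>states G. \<forall>pb\<in>states G. \<forall>pc\<in>states G. \<forall>z\<in>outputs G.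
        emits G pa pb z \<and> emits G pa pc z \<longrightarrow> pb = pc)"

text \<open>Since \<open>X\<close> need not be open, class \<open>C\<^sup>1\<close> on \<open>X\<close> means having a \<open>C\<^sup>1\<close> extension to an open
  superset of \<open>X\<close>.  For open \<open>X\<close> this is the usual notion.\<close>

definition C1_nonsingular :: "'a::real_inner set \<Rightarrow> ('a \<Rightarrow> real) \<Rightarrow> bool" where
  "C1_nonsingular X k \<longleftrightarrow>
     (\<exists>W g grad. open W \<and> X \<subseteq> W \<and> (\<forall>x\<in>X. g x = k x) \<and>
        (\<forall>x\<in>W. GDERIV g x :> grad x) \<and> continuous_on W grad \<and>
        (\<forall>x\<in>X. k x = 0 \<longrightarrow> grad x \<noteq> 0))"

locale hybrid_plant =
  fixes X :: "(real^'n) set"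
    and U :: "(real^'m) set"
    and f :: "real^'n \<Rightarrow> real^'m \<Rightarrow> real^'n"
    and R :: "'r set"
    and act :: "'r \<Rightarrow> real^'m"
    and N :: nat
    and h :: "nat \<Rightarrow> real^'n \<Rightarrow> real"
    and P :: "'p set"
    and et :: "(real^'n) set \<Rightarrow> 'p"
    and zp zm :: "nat \<Rightarrow> 'z"
begin

text \<open>\<open>f\<close> and the \<open>h i\<close> are only ever evaluated at states in \<open>X\<close>; \<open>zp i\<close> and \<open>zm i\<close> are the symbols
  of the plant-events \<open>(i+)\<close> and \<open>(i-)\<close>.\<close>

definition ker :: "nat \<Rightarrow> (real^'n) set" where
  "ker i = {x \<in> X. h i x = 0}"

definition Fr :: "(real^'n) set" where
  "Fr = (\<Union>i\<in>{1..N}. ker i)"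

definition DX :: "(real^'n) set" where
  "DX = X - Fr"

definition Intersec :: "(real^'n) set" where
  "Intersec = {x \<in> Fr. \<exists>i\<in>{1..N}. \<exists>j\<in>{1..N}. i \<noteq> j \<and> x \<in> ker i \<inter> ker j}"

definition Rel :: "((real^'n) \<times> (real^'n)) set" where
  "Rel = {(x1, x2). x1 \<in> DX \<and> x2 \<in> DX \<and> (\<forall>i\<in>{1..N}. h i x1 * h i x2 > 0)}"

definition cells :: "(real^'n) set set" where
  "cells = DX // Rel"

definition cell_of :: "'p \<Rightarrow> (real^'n) set" where
  "cell_of = inv_into cells et"

definition Z :: "'z set" where
  "Z = zp ` {1..N} \<union> zm ` {1..N}"

text \<open>Classical solutions on a time interval \<open>J\<close> with left end point \<open>tc\<close> under the constant input
  \<open>u\<close>.  Plant-events never occur simultaneously: only evolutions that stay outside \<open>Intersec\<close> are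
  considered.  No global existence in time is required.\<close>

definition evolution :: "real \<Rightarrow> real set \<Rightarrow> real^'m \<Rightarrow> (real \<Rightarrow> real^'n) \<Rightarrow> bool" where
  "evolution tc J u x \<longleftrightarrow>
     is_interval J \<and> tc \<in> J \<and> (\<forall>t\<in>J. tc \<le> t) \<and>
     (\<forall>t\<in>J. x t \<in> X) \<and>
     (\<forall>t\<in>J. (x has_vector_derivative f (x t) u) (at t within J)) \<and>
     (\<forall>t\<in>J. x t \<notin> Intersec)"

definition plus_event :: "nat \<Rightarrow> real set \<Rightarrow> (real \<Rightarrow> real^'n) \<Rightarrow> real \<Rightarrow> bool" where
  "plus_event i J x te \<longleftrightarrow>
     te \<in> J \<and> h i (x te) = 0 \<and>
     (\<exists>d1>0. \<forall>\<epsilon>. 0 < \<epsilon> \<and> \<epsilon> < d1 \<longrightarrow> te + \<epsilon> \<in> J \<and> h i (x (te + \<epsilon>)) > 0) \<and>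
     (\<exists>d2>0. te - d2 \<in> J \<and> h i (x (te - d2)) < 0 \<and>
        (\<forall>\<epsilon>. 0 < \<epsilon> \<and> \<epsilon> < d2 \<longrightarrow> h i (x (te - \<epsilon>)) \<le> 0))"

definition minus_event :: "nat \<Rightarrow> real set \<Rightarrow> (real \<Rightarrow> real^'n) \<Rightarrow> real \<Rightarrow> bool" where
  "minus_event i J x te \<longleftrightarrow>
     te \<in> J \<and> h i (x te) = 0 \<and>
     (\<exists>d1>0. \<forall>\<epsilon>. 0 < \<epsilon> \<and> \<epsilon> < d1 \<longrightarrow> te + \<epsilon> \<in> J \<and> h i (x (te + \<epsilon>)) < 0) \<and>
     (\<exists>d2>0. te - d2 \<in> J \<and> h i (x (te - d2)) > 0 \<and>
        (\<forall>\<epsilon>. 0 < \<epsilon> \<and> \<epsilon> < d2 \<longrightarrow> h i (x (te - \<epsilon>)) \<ge> 0))"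

text \<open>\<open>z = gev (x te)\<close>, as a relation: the symbol depends on the direction of the crossing and not
  only on the point \<open>x te\<close>.\<close>

definition gev :: "real set \<Rightarrow> (real \<Rightarrow> real^'n) \<Rightarrow> real \<Rightarrow> 'z \<Rightarrow> bool" where
  "gev J x te z \<longleftrightarrow>
     x te \<in> Fr - Intersec \<and>
     (\<exists>i\<in>{1..N}. plus_event i J x te \<and> z = zp i \<or> minus_event i J x te \<and> z = zm i)"

definition plant_transition :: "'p \<Rightarrow> 'r \<Rightarrow> 'z \<Rightarrow> 'p \<Rightarrow> bool" where
  "plant_transition pa r z pb \<longleftrightarrow>
     pa \<in> P \<and> pb \<in> P \<and> pa \<noteq> pb \<and> r \<in> R \<and>
     (\<exists>tc J x S te. evolution tc J (act r) x \<and> x tc \<in> cell_of pa \<and>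
        S = {t \<in> J. tc < t \<and> x t \<in> DX \<and> x t \<notin> cell_of pa} \<and> S \<noteq> {} \<and> te = Inf S \<and>
        (\<exists>d>0. \<forall>\<epsilon>. 0 < \<epsilon> \<and> \<epsilon> < d \<longrightarrow> te + \<epsilon> \<in> J \<and> x (te + \<epsilon>) \<in> cell_of pb) \<and>
        gev J x te z)"

definition f_p :: "'p \<Rightarrow> 'r \<Rightarrow> 'p set" where
  "f_p pa r = {pb. \<exists>z. plant_transition pa r z pb}"

text \<open>The description is unique whenever a transition is possible; see \<open>f_p_g_p_iff\<close> below.\<close>

definition g_p :: "'p \<Rightarrow> 'p \<Rightarrow> 'z" where
  "g_p pa pb = (THE z. \<exists>r. plant_transition pa r z pb)"

definition DES_plant :: "('p, 'r, 'z) automaton" where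
  "DES_plant = \<lparr>states = P, inputs = R, trans_fun = f_p, outputs = Z, out_fun = g_p\<rparr>"

end

text \<open>The injectivity assumption on \<open>h\<close> says that \<open>h 1, \<dots>, h N\<close> are \<open>N\<close> different functionals
  on \<open>X\<close>.\<close>

locale hybrid_control_system = hybrid_plant X U f R act N h P et zp zm
  for X :: "(real^'n) set"
    and U :: "(real^'m) set"
    and f :: "real^'n \<Rightarrow> real^'m \<Rightarrow> real^'n"
    and R :: "'r set"
    and act :: "'r \<Rightarrow> real^'m"
    and N :: nat
    and h :: "nat \<Rightarrow> real^'n \<Rightarrow> real"
    and P :: "'p set"
    and et :: "(real^'n) set \<Rightarrow> 'p"
    and zp zm :: "nat \<Rightarrow> 'z" +
  assumes finite_U: "finite U"
    and act_bij: "bij_betw act R U"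
    and N_pos: "N \<ge> 1"
    and h_regular: "\<And>i. i \<in> {1..N} \<Longrightarrow> C1_nonsingular X (h i)"
    and h_distinct: "inj_on (\<lambda>i. restrict (h i) X) {1..N}"
    and et_bij: "bij_betw et cells P"
    and zp_inj: "inj_on zp {1..N}"
    and zm_inj: "inj_on zm {1..N}"
    and zp_zm_disjoint: "zp ` {1..N} \<inter> zm ` {1..N} = {}"
begin

lemma h_continuous: "i \<in> {1..N} \<Longrightarrow> continuous_on X (h i)"
proof -
  assume "i \<in> {1..N}"
  from h_regular[OF this] obtain W g grad
    where W: "X \<subseteq> W" "\<forall>x\<in>X. g x = h i x" "\<forall>x\<in>W. GDERIV g x :> grad x"
    unfolding C1_nonsingular_def by (elim exE conjE)
  have "continuous_on X g"
  proof (rule continuous_at_imp_continuous_on, rule ballI)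
    fix x assume "x \<in> X"
    then have "GDERIV g x :> grad x" using W by blast
    then show "isCont g x" unfolding gderiv_def by (rule has_derivative_continuous)
  qed
  then show ?thesis
    using W(2) continuous_on_cong[of X X g "h i"] by blast
qed

lemma cell_of_DX: "p \<in> P \<Longrightarrow> \<exists>x0\<in>DX. cell_of p = {y \<in> DX. \<forall>i\<in>{1..N}. h i x0 * h i y > 0}"
proof -
  assume "p \<in> P"
  then have "cell_of p \<in> cells"
    using et_bij unfolding cell_of_def bij_betw_def by (metis inv_into_into)
  then show ?thesis
    unfolding cells_def quotient_def Rel_def by auto
qed

lemma DX_iff: "x \<in> DX \<longleftrightarrow> x \<in> X \<and> (\<forall>i\<in>{1..N}. h i x \<noteq> 0)"
  unfolding DX_def Fr_def ker_def by auto

lemma cell_of_iff: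
  assumes "p \<in> P" "x \<in> cell_of p"
  shows "x \<in> DX" "y \<in> cell_of p \<longleftrightarrow> y \<in> DX \<and> (\<forall>i\<in>{1..N}. h i x * h i y > 0)"
proof -
  obtain x0 where x0: "x0 \<in> DX" "cell_of p = {y \<in> DX. \<forall>i\<in>{1..N}. h i x0 * h i y > 0}"
    using cell_of_DX assms by blast
  show "x \<in> DX" using x0 assms by auto
  have "\<forall>i\<in>{1..N}. h i x0 * h i x > 0" using x0 assms by auto
  then have "(h i x0 * h i y > 0) = (h i x * h i y > 0)" if "i \<in> {1..N}" for i
    using that by (metis zero_less_mult_iff not_less_iff_gr_or_eq)
  then show "y \<in> cell_of p \<longleftrightarrow> y \<in> DX \<and> (\<forall>i\<in>{1..N}. h i x * h i y > 0)"
    using x0 by auto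
qed

lemma cell_of_inj:
  assumes "p \<in> P" "q \<in> P" "cell_of p = cell_of q"
  shows "p = q"
proof -
  have "et (cell_of r) = r" if "r \<in> P" for r
    using bij_betw_inv_into_right[OF et_bij that] unfolding cell_of_def .
  then show ?thesis using assms by metis
qed

text \<open>Before the first visit to another cell, no functional takes a value of the sign opposite to
  the one it has on the starting cell.\<close>

lemma no_sign_change:
  assumes ev: "evolution tc J u x" and pa: "pa \<in> P" "x tc \<in> cell_of pa"
    and before: "\<And>s. s \<in> J \<Longrightarrow> tc < s \<Longrightarrow> s < te \<Longrightarrow> x s \<in> DX \<Longrightarrow> x s \<in> cell_of pa"
    and t: "t \<in> J" "t < te" and j: "j \<in> {1..N}"
  shows "h j (x tc) * h j (x t) \<ge> 0"
proof (rule ccontr)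
  assume neg: "\<not> ?thesis"
  define \<phi> where "\<phi> s = h j (x tc) * h j (x s)" for s
  have J: "is_interval J" "tc \<in> J" "\<And>t. t \<in> J \<Longrightarrow> tc \<le> t" "\<And>t. t \<in> J \<Longrightarrow> x t \<in> X"
    "\<And>t. t \<in> J \<Longrightarrow> x t \<notin> Intersec"
    using ev unfolding evolution_def by auto
  have x_cont: "continuous_on J x"
    using ev unfolding evolution_def continuous_on_eq_continuous_within
    by (auto intro: has_vector_derivative_continuous)
  have hx_cont: "continuous_on J (\<lambda>s. h k (x s))" if "k \<in> {1..N}" for k
    using continuous_on_compose2[OF h_continuous[OF that] x_cont] J(4) by auto
  have sub: "{tc..t} \<subseteq> J"
    using J(1,2) t(1) by (meson atLeastAtMost_iff mem_is_interval_1_I subsetI)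
  have \<phi>_cont: "continuous_on {tc..t} \<phi>"
    unfolding \<phi>_def by (intro continuous_intros continuous_on_subset[OF hx_cont[OF j] sub])
  have \<phi>t: "\<phi> t < 0" using neg unfolding \<phi>_def by auto
  have "x tc \<in> DX" using cell_of_iff(1)[OF pa] .
  then have \<phi>tc: "\<phi> tc > 0"
    using j unfolding \<phi>_def DX_iff by (auto simp: zero_less_mult_iff linorder_neq_iff)
  define A where "A = {s \<in> {tc..t}. \<phi> s \<in> {0..}}"
  have "A = {tc..t} \<inter> \<phi> -` {0..}"
    unfolding A_def by auto
  then have "closed A"
    using continuous_closed_preimage[OF \<phi>_cont] by simp
  have A0: "tc \<in> A" using \<phi>tc J(3)[OF t(1)] unfolding A_def by auto
  have Abd: "bdd_above A" unfolding A_def by (rule bdd_aboveI[of _ t]) auto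
  define s where "s = Sup A"
  have sA: "s \<in> A"
    unfolding s_def using closed_contains_Sup[OF _ Abd \<open>closed A\<close>] A0 by blast
  have after: "\<phi> r < 0" if "s < r" "r \<le> t" for r
  proof (rule ccontr)
    assume "\<not> \<phi> r < 0"
    then have "r \<in> A" using that sA unfolding A_def by auto
    then have "r \<le> s" unfolding s_def using Abd by (rule cSup_upper)
    then show False using that by simp
  qed
  have st: "tc \<le> s" "s < t" "\<phi> s \<ge> 0"
    using sA \<phi>t unfolding A_def by (auto simp: less_le)
  have sJ: "s \<in> J" using st sub by auto
  have "\<phi> s = 0"
  proof (rule ccontr)
    assume "\<phi> s \<noteq> 0"
    then have "0 < \<phi> s" using st by auto
    then obtain r where "s \<le> r" "r \<le> t" "\<phi> r = 0"
      using IVT2'[of \<phi> t 0 s] \<phi>t st continuous_on_subset[OF \<phi>_cont, of "{s..t}"] by auto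
    then show False using after[of r] \<open>\<phi> s \<noteq> 0\<close> by (cases "r = s") auto
  qed
  then have hjs: "h j (x s) = 0" using \<phi>tc unfolding \<phi>_def by auto
  have other: "h k (x s) \<noteq> 0" if "k \<in> {1..N}" "k \<noteq> j" for k
  proof
    assume "h k (x s) = 0"
    then have "x s \<in> Intersec"
      using J(4)[OF sJ] hjs that j unfolding Intersec_def Fr_def ker_def by blast
    then show False using J(5)[OF sJ] by simp
  qed
  have "eventually (\<lambda>r. \<forall>k\<in>{1..N} - {j}. h k (x r) \<noteq> 0) (at s within J)"
  proof (intro eventually_ball_finite ballI)
    fix k assume k: "k \<in> {1..N} - {j}"
    have "((\<lambda>r. h k (x r)) \<longlongrightarrow> h k (x s)) (at s within J)"
      using hx_cont[of k] k sJ unfolding continuous_on_def by blast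
    then show "eventually (\<lambda>r. h k (x r) \<noteq> 0) (at s within J)"
      using other[of k] k by (intro tendsto_imp_eventually_ne) auto
  qed auto
  then obtain d where d: "d > 0"
    "\<And>r. r \<in> J \<Longrightarrow> r \<noteq> s \<Longrightarrow> dist r s < d \<Longrightarrow> \<forall>k\<in>{1..N} - {j}. h k (x r) \<noteq> 0"
    unfolding eventually_at by blast
  define r where "r = min t (s + d / 2)"
  have r: "s < r" "r \<le> t" "dist r s < d" using st d(1) unfolding r_def dist_real_def by auto
  then have rJ: "r \<in> J" using st sub by auto
  have "h j (x r) \<noteq> 0" using after[OF r(1,2)] unfolding \<phi>_def by auto
  then have "x r \<in> DX"
    using d(2)[OF rJ _ r(3)] r(1) J(4)[OF rJ] unfolding DX_iff by blast
  then have "x r \<in> cell_of pa" using before[OF rJ] r st t by auto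
  then have "\<phi> r > 0" using cell_of_iff(2)[OF pa] j unfolding \<phi>_def by auto
  then show False using after[OF r(1,2)] by simp
qed

text \<open>A transition with symbol \<open>zp i\<close> or \<open>zm i\<close> keeps the sign of every functional other than
  \<open>h i\<close>, and the sign of \<open>h i\<close> on the target cell is that of the symbol.\<close>

lemma transition_signs:
  assumes "plant_transition pa r z pb"
  obtains i a b where "i \<in> {1..N}" "a \<in> cell_of pa" "b \<in> cell_of pb"
    "z = zp i \<and> h i b > 0 \<or> z = zm i \<and> h i b < 0"
    "\<And>j. j \<in> {1..N} \<Longrightarrow> j \<noteq> i \<Longrightarrow> h j a * h j b > 0"
proof -
  from assms obtain tc J x S te d where
    P: "pa \<in> P" "pb \<in> P" and
    ev: "evolution tc J (act r) x" "x tc \<in> cell_of pa" and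
    S: "S = {t \<in> J. tc < t \<and> x t \<in> DX \<and> x t \<notin> cell_of pa}" "te = Inf S" and
    d: "d > 0" "\<And>\<epsilon>. 0 < \<epsilon> \<Longrightarrow> \<epsilon> < d \<Longrightarrow> te + \<epsilon> \<in> J \<and> x (te + \<epsilon>) \<in> cell_of pb" and
    g: "gev J x te z"
    unfolding plant_transition_def by blast
  from g obtain i where i: "i \<in> {1..N}"
    "plus_event i J x te \<and> z = zp i \<or> minus_event i J x te \<and> z = zm i"
    and teI: "x te \<notin> Intersec"
    unfolding gev_def by blast
  have te: "te \<in> J" "h i (x te) = 0"
    using i(2) unfolding plus_event_def minus_event_def by auto
  obtain d1 where d1: "d1 > 0" "\<And>\<epsilon>. 0 < \<epsilon> \<Longrightarrow> \<epsilon> < d1 \<Longrightarrow>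
      z = zp i \<and> h i (x (te + \<epsilon>)) > 0 \<or> z = zm i \<and> h i (x (te + \<epsilon>)) < 0"
    using i(2) unfolding plus_event_def minus_event_def by blast
  have J: "is_interval J" "tc \<in> J" "\<And>t. t \<in> J \<Longrightarrow> tc \<le> t" "\<And>t. t \<in> J \<Longrightarrow> x t \<in> X"
    using ev(1) unfolding evolution_def by auto
  have "x tc \<in> DX" using cell_of_iff(1)[OF P(1) ev(2)] .
  then have "te \<noteq> tc" using te(2) i(1) unfolding DX_iff by auto
  then have tcte: "tc < te" using J(3)[OF te(1)] by simp
  have x_cont: "continuous_on J x"
    using ev(1) unfolding evolution_def continuous_on_eq_continuous_within
    by (auto intro: has_vector_derivative_continuous)
  have bdd: "bdd_below S" unfolding S(1) by (rule bdd_belowI[of _ tc]) auto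
  have before: "x s \<in> cell_of pa" if "s \<in> J" "tc < s" "s < te" "x s \<in> DX" for s
  proof (rule ccontr)
    assume "x s \<notin> cell_of pa"
    then have "s \<in> S" using that S(1) by auto
    then have "te \<le> s" unfolding S(2) using bdd by (intro cInf_lower)
    then show False using that by simp
  qed
  have pos: "h j (x tc) * h j (x te) > 0" if j: "j \<in> {1..N}" "j \<noteq> i" for j
  proof -
    have "h j (x te) \<noteq> 0"
      using teI te i(1) j J(4)[OF te(1)] unfolding Intersec_def Fr_def ker_def by blast
    moreover have "h j (x tc) \<noteq> 0" using \<open>x tc \<in> DX\<close> j unfolding DX_iff by auto
    moreover have "h j (x tc) * h j (x te) \<ge> 0"
    proof -
      have sub: "{tc<..<te} \<subseteq> J"
        using J(1,2) te(1) by (meson greaterThanLessThan_iff less_imp_le mem_is_interval_1_I subsetI)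
      have "continuous_on J (\<lambda>s. h j (x s))"
        using continuous_on_compose2[OF h_continuous[OF j(1)] x_cont] J(4) by auto
      then have "((\<lambda>s. h j (x tc) * h j (x s)) \<longlongrightarrow> h j (x tc) * h j (x te)) (at te within J)"
        using te(1) unfolding continuous_on_def by (auto intro!: tendsto_mult_left)
      then have "((\<lambda>s. h j (x tc) * h j (x s)) \<longlongrightarrow> h j (x tc) * h j (x te)) (at te within {tc<..<te})"
        using tendsto_within_subset sub by blast
      moreover have "eventually (\<lambda>s. 0 \<le> h j (x tc) * h j (x s)) (at te within {tc<..<te})"
        using no_sign_change[OF ev(1) P(1) ev(2) before _ _ j(1)] sub
        unfolding eventually_at by (intro exI[of _ 1]) auto
      moreover have "at te within {tc<..<te} \<noteq> bot"
        using tcte by (simp add: at_within_eq_bot_iff)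
      ultimately show ?thesis by (rule tendsto_lowerbound)
    qed
    ultimately show ?thesis by (simp add: less_le)
  qed
  have "eventually (\<lambda>s. \<forall>j\<in>{1..N} - {i}. h j (x tc) * h j (x s) > 0) (at te within J)"
  proof (intro eventually_ball_finite ballI)
    fix j assume j: "j \<in> {1..N} - {i}"
    have "continuous_on J (\<lambda>s. h j (x s))"
      using continuous_on_compose2[OF h_continuous x_cont] J(4) j by auto
    then have "((\<lambda>s. h j (x tc) * h j (x s)) \<longlongrightarrow> h j (x tc) * h j (x te)) (at te within J)"
      using te(1) unfolding continuous_on_def by (auto intro!: tendsto_mult_left)
    then show "eventually (\<lambda>s. h j (x tc) * h j (x s) > 0) (at te within J)"
      using pos[of j] j by (auto intro: order_tendstoD(1))
  qed auto
  then obtain d2 where d2: "d2 > 0" "\<And>s. s \<in> J \<Longrightarrow> s \<noteq> te \<Longrightarrow> dist s te < d2 \<Longrightarrow>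
      \<forall>j\<in>{1..N} - {i}. h j (x tc) * h j (x s) > 0"
    unfolding eventually_at by blast
  define \<epsilon> where "\<epsilon> = min d (min d1 d2) / 2"
  have \<epsilon>: "0 < \<epsilon>" "\<epsilon> < d" "\<epsilon> < d1" "\<epsilon> < d2"
    unfolding \<epsilon>_def using d(1) d1(1) d2(1) by auto
  show ?thesis
  proof (rule that[of i "x tc" "x (te + \<epsilon>)"])
    show "h j (x tc) * h j (x (te + \<epsilon>)) > 0" if "j \<in> {1..N}" "j \<noteq> i" for j
      using d2(2)[of "te + \<epsilon>"] d(2)[of \<epsilon>] \<epsilon> that by (auto simp: dist_real_def)
  qed (use i ev d d1 \<epsilon> in auto)
qed

lemma transition_output_unique:
  assumes t: "plant_transition pa r z pb" and t': "plant_transition pa r' z' pb"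
  shows "z = z'"
proof -
  obtain i a b where i: "i \<in> {1..N}" "a \<in> cell_of pa" "b \<in> cell_of pb"
    "z = zp i \<and> h i b > 0 \<or> z = zm i \<and> h i b < 0"
    "\<And>j. j \<in> {1..N} \<Longrightarrow> j \<noteq> i \<Longrightarrow> h j a * h j b > 0"
    using transition_signs[OF t] by blast
  obtain i' a' b' where i': "i' \<in> {1..N}" "a' \<in> cell_of pa" "b' \<in> cell_of pb"
    "z' = zp i' \<and> h i' b' > 0 \<or> z' = zm i' \<and> h i' b' < 0"
    "\<And>j. j \<in> {1..N} \<Longrightarrow> j \<noteq> i' \<Longrightarrow> h j a' * h j b' > 0"
    using transition_signs[OF t'] by blast
  have P: "pa \<in> P" "pb \<in> P" "pa \<noteq> pb" using t unfolding plant_transition_def by auto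
  have bb: "h j b * h j b' > 0" if "j \<in> {1..N}" for j
    using cell_of_iff(2)[OF P(2) i(3)] i'(3) that by auto
  have aa: "h j a * h j a' > 0" if "j \<in> {1..N}" for j
    using cell_of_iff(2)[OF P(1) i(2)] i'(2) that by auto
  have "i = i'"
  proof (rule ccontr)
    assume ne: "i \<noteq> i'"
    have same: "h j a * h j b > 0" if j: "j \<in> {1..N}" for j
    proof (cases "j = i")
      case True
      then show ?thesis using i'(5)[OF j] ne aa[OF j] bb[OF j]
        by (auto simp: zero_less_mult_iff)
    next
      case False
      then show ?thesis using i(5)[OF j] by simp
    qed
    have bDX: "b \<in> DX" using cell_of_iff(1)[OF P(2) i(3)] .
    then have "b \<in> cell_of pa" using cell_of_iff(2)[OF P(1) i(2)] same by auto
    then have "cell_of pa = cell_of pb"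
      using cell_of_iff(2)[OF P(1), of b] cell_of_iff(2)[OF P(2) i(3)] by blast
    then show False using cell_of_inj P by blast
  qed
  then show ?thesis using i(1,4) i'(4) bb[OF i(1)] by (auto simp: zero_less_mult_iff)
qed

lemma f_p_g_p_iff: "pb \<in> f_p pa r \<and> g_p pa pb = z \<longleftrightarrow> plant_transition pa r z pb"
proof -
  have "g_p pa pb = z'" if "plant_transition pa r' z' pb" for r' z'
    unfolding g_p_def using that transition_output_unique by (intro the_equality) blast+
  then show ?thesis unfolding f_p_def by auto
qed

end

end

theory Submission
  imports Defs
begin

text \<open>A transition changes the sign of exactly one functional, and its symbol says which one and
  what the new sign is.  The signs on the source cell and the symbol therefore determine all signs
  on the target cell, hence the target cell itself.\<close>

lemma (in hybrid_control_system) transition_target_unique: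
  assumes t: "plant_transition pa r z pb" and t': "plant_transition pa r' z pc"
  shows "pb = pc"
proof -
  obtain i a b where i: "i \<in> {1..N}" "a \<in> cell_of pa" "b \<in> cell_of pb"
    "z = zp i \<and> h i b > 0 \<or> z = zm i \<and> h i b < 0"
    "\<And>j. j \<in> {1..N} \<Longrightarrow> j \<noteq> i \<Longrightarrow> h j a * h j b > 0"
    using transition_signs[OF t] by blast
  obtain i' a' c where i': "i' \<in> {1..N}" "a' \<in> cell_of pa" "c \<in> cell_of pc"
    "z = zp i' \<and> h i' c > 0 \<or> z = zm i' \<and> h i' c < 0"
    "\<And>j. j \<in> {1..N} \<Longrightarrow> j \<noteq> i' \<Longrightarrow> h j a' * h j c > 0"
    using transition_signs[OF t'] by blast
  have P: "pa \<in> P" "pb \<in> P" "pc \<in> P"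
    using t t' unfolding plant_transition_def by auto
  \<comment> \<open>Disjointness rules out mixed directions, so both symbols are \<open>zp\<close>
    or both are \<open>zm\<close>. Injectivity then yields the same index, and the common direction
    the same sign at \<open>b\<close> and \<open>c\<close>.\<close>
  have "zp i \<noteq> zm i'" "zm i \<noteq> zp i'"
    using zp_zm_disjoint i(1) i'(1) by blast+
  then have same: "i = i'" "h i b * h i c > 0"
    using i(1,4) i'(1,4) inj_onD[OF zp_inj, of i i'] inj_onD[OF zm_inj, of i i']
    by (auto simp: zero_less_mult_iff)
  have "h j b * h j c > 0" if j: "j \<in> {1..N}" for j
  proof (cases "j = i")
    case True
    then show ?thesis using same by simp
  next
    case False
    \<comment> \<open>The two evolutions may start at different points of the source cell; its
      constant signs link the chain \<open>b\<close>, \<open>a\<close>, \<open>a'\<close>,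
      \<open>c\<close>.\<close>
    have "h j a * h j a' > 0"
      using cell_of_iff(2)[OF P(1) i(2)] i'(2) j by auto
    then show ?thesis
      using i(5)[OF j False] i'(5)[OF j] False same(1) by (auto simp: zero_less_mult_iff)
  qed
  then have "c \<in> cell_of pb"
    using cell_of_iff(2)[OF P(2) i(3)] cell_of_iff(1)[OF P(3) i'(3)] by blast
  \<comment> \<open>Both cells contain \<open>c\<close>, and any of its points determines a
    cell.\<close>
  then have "cell_of pb = cell_of pc"
    using cell_of_iff(2)[OF P(2), of c] cell_of_iff(2)[OF P(3) i'(3)] by blast
  then show ?thesis using cell_of_inj P by blast
qed

theorem proposition1:
  fixes X :: "(real^'n) set"
    and U :: "(real^'m) set"
    and f :: "real^'n \<Rightarrow> real^'m \<Rightarrow> real^'n"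
    and R :: "'r set"
    and act :: "'r \<Rightarrow> real^'m"
    and N :: nat
    and h :: "nat \<Rightarrow> real^'n \<Rightarrow> real"
    and P :: "'p set"
    and et :: "(real^'n) set \<Rightarrow> 'p"
    and zp zm :: "nat \<Rightarrow> 'z"
  assumes "hybrid_control_system X U R act N h P et zp zm"
  shows "observable (hybrid_plant.DES_plant X f R act N h P et zp zm)"
proof -
  interpret hybrid_control_system X U f R act N h P et zp zm
    by (rule assms)
  \<comment> \<open>By \<open>f_p_g_p_iff\<close>, the value chosen by \<open>THE\<close> in
    \<open>g_p\<close> is the symbol of an actual transition. The control symbol \<open>r\<close>
    may differ between the two emissions, which \<open>transition_target_unique\<close>
    allows.\<close>
  have "\<exists>r. plant_transition pa r z pb" if "emits DES_plant pa pb z" for pa pb z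
    using that unfolding emits_def DES_plant_def by (auto simp flip: f_p_g_p_iff)
  then show ?thesis
    unfolding observable_def using transition_target_unique by blast
qed

end
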